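(* For every integer $n\geq 0$, $(-1)^n\, Q_2(n) = b_{6,e}(n)-b_{6,o}(n)$.
   Context: A partition is called $6$-regular if none of its parts is divisible by $6$. $b_{6,e}(n)$ (respectively $b_{6,o}(n)$) denotes the number of $6$-regular partitions of $n$ into an even (respectively odd) number of parts, where parts are counted with multiplicity. $Q_2(n)$ denotes the number of partitions of $n$ into distinct parts which are not congruent to $\pm 2$ modulo $6$. The empty partition is the only partition of $0$ and has $0$ parts. *)

theory Defs
  imports "HOL-Library.Multiset" "HOL-Number_Theory.Cong"
begin

text \<open>A partition of \<open>n\<close> is the multiset of its parts, so \<open>size p\<close> is the number of
  parts counted with multiplicity.\<close>

definition partitions_of :: "nat \<Rightarrow> nat multiset set" where
  "partitions_of n = {p. (\<forall>k\<in>#p. k > 0) \<and> sum_mset p = n}"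

definition regular :: "nat \<Rightarrow> nat multiset \<Rightarrow> bool" where
  "regular l p \<longleftrightarrow> (\<forall>k\<in>#p. \<not> l dvd k)"

definition b_even :: "nat \<Rightarrow> nat \<Rightarrow> nat" where
  "b_even l n = card {p \<in> partitions_of n. regular l p \<and> even (size p)}"

definition b_odd :: "nat \<Rightarrow> nat \<Rightarrow> nat" where
  "b_odd l n = card {p \<in> partitions_of n. regular l p \<and> odd (size p)}"

definition Q2 :: "nat \<Rightarrow> nat" where
  "Q2 n = card {p \<in> partitions_of n. (\<forall>k\<in>#p. count p k = 1) \<and>
     (\<forall>k\<in>#p. \<not> [int k = 2] (mod 6) \<and> \<not> [int k = - 2] (mod 6))}"

text \<open>The cardinalities above are those of finite sets.\<close>

lemma finite_partitions_of: "finite (partitions_of n)"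
proof -
  have size_le: "size p \<le> sum_mset p" if "\<forall>k\<in>#p. k > 0" for p :: "nat multiset"
    using that by (induction p) auto
  have part_le: "k \<le> sum_mset p" if "k \<in># p" for k and p :: "nat multiset"
    using multi_member_split[OF that] by auto
  have "partitions_of n \<subseteq> (\<Union>m\<le>n. multisets_of_size {..n} m)"
    unfolding partitions_of_def multisets_of_size_def using size_le part_le by auto
  moreover have "finite (\<Union>m\<le>n. multisets_of_size {..n} m)"
    by (auto intro: finite_multisets_of_size)
  ultimately show ?thesis
    by (rule finite_subset)
qed

lemma partitions_of_0: "partitions_of 0 = {{#}}"
proof -
  have "p = {#}" if "p \<in> partitions_of 0" for p
    using that by (cases p) (auto simp: partitions_of_def)
  moreover have "{#} \<in> partitions_of 0"
    by (simp add: partitions_of_def)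
  ultimately show ?thesis
    by blast
qed

end

theory Submission
  imports Defs "HOL-Computational_Algebra.Formal_Power_Series"
begin

text \<open>Weighting a partition by \<open>(-1)\<close> to the number of its parts, the 6-regular partitions have
  generating function \<open>\<Prod>\<^bsub>6 \<nmid> k\<^esub> 1 / (1 + q\<^sup>k)\<close>. Euler's identity
  \<open>\<Prod>\<^bsub>k\<^esub> (1 + q\<^sup>k) \<cdot> \<Prod>\<^bsub>k odd\<^esub> (1 - q\<^sup>k) = 1\<close> turns this into
  \<open>\<Prod>\<^bsub>k odd\<^esub> (1 - q\<^sup>k) \<cdot> \<Prod>\<^bsub>6 | k\<^esub> (1 + q\<^sup>k)\<close>, which counts partitions into distinct parts that are
  odd or divisible by 6, with sign \<open>(-1)\<^sup>n\<close>. Infinite products are avoided by allowing only parts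
  at most \<open>n\<close>, so that Euler's identity holds modulo \<open>q\<^bsup>n+1\<^esup>\<close>.\<close>

unbundle fps_syntax

text \<open>The set \<open>A\<close> of allowed parts is a parameter so that the product formula can
  be proved by admitting one part at a time.\<close>

definition signed_partition_fps :: "nat set \<Rightarrow> int fps" where
  "signed_partition_fps A =
     Abs_fps (\<lambda>n. \<Sum>p\<in>{p \<in> partitions_of n. set_mset p \<subseteq> A}. (- 1) ^ size p)"

lemma signed_partition_fps_empty: "signed_partition_fps {} = 1"
proof (rule fps_ext)
  fix n
  have "{p \<in> partitions_of n. set_mset p \<subseteq> {}} = (if n = 0 then {{#}} else {})"
    by (auto simp: partitions_of_def)
  then show "signed_partition_fps {} $ n = 1 $ n"
    by (simp add: signed_partition_fps_def)
qed

text \<open>Partitions containing \<open>k\<close> correspond to those of \<open>n - k\<close> by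
  removing one copy of \<open>k\<close>. This flips the sign, and \<open>k\<close> may still occur
  in the rest.\<close>

lemma signed_partition_fps_insert:
  assumes "k > 0" "k \<notin> A"
  shows "(1 + fps_X ^ k) * signed_partition_fps (insert k A) = signed_partition_fps A"
proof (rule fps_ext)
  fix n
  let ?w = "\<lambda>p :: nat multiset. (- 1) ^ size p :: int"
  let ?P = "\<lambda>n A. {p \<in> partitions_of n. set_mset p \<subseteq> A}"
  let ?C = "{p \<in> ?P n (insert k A). k \<in># p}"
  have fin: "finite (?P n B)" for n B
    by (rule finite_subset[OF _ finite_partitions_of[of n]]) auto
  have split: "?P n (insert k A) = ?P n A \<union> ?C" "?P n A \<inter> ?C = {}"
    using assms by auto
  have "sum ?w (?P n (insert k A)) = sum ?w (?P n A) + sum ?w ?C"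
    using sum.union_disjoint[OF fin finite_subset[OF _ fin] split(2), of n "insert k A" ?w]
    by (simp only: split(1)[symmetric]) auto
  moreover have "sum ?w ?C = (if n < k then 0 else - sum ?w (?P (n - k) (insert k A)))"
  proof (cases "n < k")
    case True
    have "?C = {}"
      using True by (auto simp: partitions_of_def dest!: multi_member_split)
    with True show ?thesis by (simp only: sum.empty if_True)
  next
    case False
    have "?C = add_mset k ` ?P (n - k) (insert k A)"
    proof (intro equalityI subsetI)
      fix p assume "p \<in> ?C"
      moreover from this obtain r where "p = add_mset k r"
        by (auto dest: multi_member_split)
      ultimately show "p \<in> add_mset k ` ?P (n - k) (insert k A)"
        by (auto simp: partitions_of_def)
    qed (use False assms in \<open>auto simp: partitions_of_def\<close>)
    moreover have "inj_on (add_mset k) (?P (n - k) (insert k A))"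
      by (auto simp: inj_on_def)
    ultimately show ?thesis
      using False by (simp add: sum.reindex sum_negf)
  qed
  ultimately show "((1 + fps_X ^ k) * signed_partition_fps (insert k A)) $ n
      = signed_partition_fps A $ n"
    by (simp add: signed_partition_fps_def distrib_right fps_X_power_mult_nth)
qed

lemma prod_mult_signed_partition_fps:
  assumes "finite A" "0 \<notin> A"
  shows "(\<Prod>k\<in>A. 1 + fps_X ^ k) * signed_partition_fps A = 1"
  using assms
proof (induction A)
  case empty
  then show ?case by (simp add: signed_partition_fps_empty)
next
  case (insert k A)
  then have "(\<Prod>k\<in>insert k A. 1 + fps_X ^ k) * signed_partition_fps (insert k A)
      = (\<Prod>k\<in>A. 1 + fps_X ^ k) * ((1 + fps_X ^ k) * signed_partition_fps (insert k A))"
    by (simp add: algebra_simps)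
  with insert show ?case
    by (simp add: signed_partition_fps_insert)
qed

lemma distinct_partitions_eq_image_mset_set:
  assumes "finite A" "0 \<notin> A"
  shows "{p \<in> partitions_of n. (\<forall>k\<in>#p. count p k = 1) \<and> set_mset p \<subseteq> A}
      = mset_set ` {S \<in> Pow A. \<Sum>S = n}"
proof (intro equalityI subsetI)
  fix p assume p: "p \<in> {p \<in> partitions_of n. (\<forall>k\<in>#p. count p k = 1) \<and> set_mset p \<subseteq> A}"
  then have "p = mset_set (set_mset p)"
    by (auto simp: multiset_eq_iff count_mset_set' not_in_iff)
  moreover from this have "\<Sum>(set_mset p) = sum_mset p"
    by (metis sum_unfold_sum_mset image_mset.identity id_apply multiset.map_ident)
  ultimately show "p \<in> mset_set ` {S \<in> Pow A. \<Sum>S = n}"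
    using p by (auto simp: partitions_of_def)
next
  fix p assume "p \<in> mset_set ` {S \<in> Pow A. \<Sum>S = n}"
  then obtain S where S: "p = mset_set S" "S \<subseteq> A" "\<Sum>S = n"
    by auto
  moreover have "finite S"
    using S assms finite_subset by blast
  moreover have "sum_mset (mset_set S) = \<Sum>S"
    by (simp add: sum_unfold_sum_mset)
  ultimately show "p \<in> {p \<in> partitions_of n. (\<forall>k\<in>#p. count p k = 1) \<and> set_mset p \<subseteq> A}"
    using assms by (auto simp: partitions_of_def intro!: Nat.gr0I)
qed

text \<open>Expanding the product gives one term per subset of \<open>A\<close>, and a subset is the
  same as a partition into distinct parts from \<open>A\<close>. The sign depends only on the sum of
  the subset.\<close>

lemma fps_nth_prod_one_plus_uminus_X_power:
  assumes "finite A" "0 \<notin> A"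
  shows "(\<Prod>k\<in>A. 1 + (- fps_X) ^ k :: int fps) $ n
      = (- 1) ^ n * int (card {p \<in> partitions_of n. (\<forall>k\<in>#p. count p k = 1) \<and> set_mset p \<subseteq> A})"
proof -
  have "(\<Prod>k\<in>A. 1 + (- fps_X) ^ k :: int fps) = (\<Prod>k\<in>A. (- fps_X) ^ k + 1)"
    by (simp add: add.commute)
  also have "\<dots> = (\<Sum>S\<in>Pow A. (- fps_X) ^ \<Sum>S)"
    by (subst prod_add) (auto simp: assms power_sum)
  also have "\<dots> $ n = (\<Sum>S\<in>Pow A. if \<Sum>S = n then (- 1) ^ n else 0)"
    by (auto simp: fps_sum_nth power_minus[of fps_X] fps_X_power_mult_right_nth
        minus_one_power_iff intro!: sum.cong)
  also have "\<dots> = (- 1) ^ n * int (card {S \<in> Pow A. \<Sum>S = n})"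
    using assms by (simp add: sum.If_cases Int_def)
  also have "card {S \<in> Pow A. \<Sum>S = n} = card (mset_set ` {S \<in> Pow A. \<Sum>S = n})"
    using assms by (intro card_image[symmetric] inj_onI)
      (metis (mono_tags, lifting) PowD finite_set_mset_mset_set finite_subset mem_Collect_eq)
  finally show ?thesis
    using distinct_partitions_eq_image_mset_set[OF assms] by simp
qed

text \<open>Every factor is 1 modulo \<open>fps_X ^ (i + 1)\<close>. This later discards the error
  term of the truncated Euler identity.\<close>

lemma fps_nth_prod_one_minus_X_power_low:
  assumes "finite A" "\<And>k. k \<in> A \<Longrightarrow> i < k"
  shows "(\<Prod>k\<in>A. 1 - fps_X ^ k :: 'a :: comm_ring_1 fps) $ i = of_bool (i = 0)"
  using assms
  by (induction A) (auto simp: left_diff_distrib fps_X_power_mult_nth)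

text \<open>Multiply by the factors with even \<open>k\<close> up to \<open>n\<close> and use
  \<open>(1 - x) * (1 + x) = 1 - x^2\<close>. The exponents become the even numbers up to
  \<open>2 * n\<close>, and those up to \<open>n\<close> cancel.\<close>

lemma euler_odd_distinct_finite:
  "(\<Prod>k\<in>{k \<in> {1..n}. odd k}. 1 - fps_X ^ k) * (\<Prod>k\<in>{1..n}. 1 + fps_X ^ k)
    = (\<Prod>k\<in>{k \<in> {n<..2*n}. even k}. 1 - fps_X ^ k :: int fps)"
proof -
  let ?f = "\<lambda>k. 1 - fps_X ^ k :: int fps"
  let ?O = "{k \<in> {1..n}. odd k}" and ?E = "{k \<in> {1..n}. even k}"
    and ?R = "{k \<in> {n<..2*n}. even k}"
  \<comment> \<open>Needed for the final cancellation: integer power series form an integral domain,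
    and each factor is nonzero.\<close>
  have nz: "prod ?f ?E \<noteq> 0"
  proof -
    have "?f k \<noteq> 0" if "k > 0" for k
      using that by (metis fps_X_power_nth fps_sub_nth fps_one_nth fps_zero_nth diff_zero
          less_irrefl zero_neq_one)
    then show ?thesis by auto
  qed
  have "?O \<union> ?E = {1..n}" "?O \<inter> ?E = {}"
    by auto
  then have "prod ?f ?O * prod ?f ?E = prod ?f {1..n}"
    by (metis (no_types, lifting) finite_Un finite_atLeastAtMost prod.union_disjoint)
  then have "prod ?f ?E * (prod ?f ?O * (\<Prod>k\<in>{1..n}. 1 + fps_X ^ k))
      = (\<Prod>k\<in>{1..n}. ?f k * (1 + fps_X ^ k))"
    by (simp add: prod.distrib mult_ac)
  also have "\<dots> = (\<Prod>k\<in>{1..n}. ?f (2 * k))"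
    by (simp add: algebra_simps mult_2_right power_add)
  also have "\<dots> = prod ?f ((*) 2 ` {1..n})"
    by (subst prod.reindex) (auto simp: inj_on_def)
  also have "(*) 2 ` {1..n} = ?E \<union> ?R"
    by (auto elim!: evenE)
  also have "prod ?f \<dots> = prod ?f ?E * prod ?f ?R"
    by (rule prod.union_disjoint) auto
  finally show ?thesis
    using mult_left_cancel[OF nz] by blast
qed

text \<open>All parts of a partition of \<open>n\<close> lie in \<open>{1..n}\<close>, so the bound
  on the parts does not affect this coefficient.\<close>

lemma fps_nth_signed_partition_fps_regular:
  "signed_partition_fps {k \<in> {1..n}. \<not> l dvd k} $ n = int (b_even l n) - int (b_odd l n)"
proof -
  let ?E = "{p \<in> partitions_of n. regular l p \<and> even (size p)}"
  let ?O = "{p \<in> partitions_of n. regular l p \<and> odd (size p)}"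
  have "{p \<in> partitions_of n. set_mset p \<subseteq> {k \<in> {1..n}. \<not> l dvd k}} = ?E \<union> ?O"
    by (auto simp: partitions_of_def regular_def subset_iff Suc_le_eq dest!: multi_member_split)
  moreover have "(\<Sum>p\<in>?E \<union> ?O. (- 1) ^ size p :: int)
      = (\<Sum>p\<in>?E. (- 1) ^ size p) + (\<Sum>p\<in>?O. (- 1) ^ size p)"
    by (rule sum.union_disjoint) (auto intro: finite_subset[OF _ finite_partitions_of])
  ultimately show ?thesis
    by (simp add: signed_partition_fps_def b_even_def b_odd_def)
qed

lemma Q2_eq_card:
  "Q2 n = card {p \<in> partitions_of n. (\<forall>k\<in>#p. count p k = 1) \<and>
     set_mset p \<subseteq> {k \<in> {1..n}. odd k \<or> 6 dvd k}}"
proof -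
  have "\<not> [int k = 2] (mod 6) \<and> \<not> [int k = - 2] (mod 6) \<longleftrightarrow> odd k \<or> 6 dvd k" for k :: nat
    by (simp add: cong_def) presburger
  moreover have "k \<in> {1..n}" if "p \<in> partitions_of n" "k \<in># p" for p k
    using that by (auto simp: partitions_of_def Suc_le_eq dest!: multi_member_split)
  ultimately show ?thesis
    unfolding Q2_def by (intro arg_cong[where f = card]) blast
qed

theorem theorem1p3:
  fixes n :: nat
  shows "(- 1) ^ n * int (Q2 n) = int (b_even 6 n) - int (b_odd 6 n)"
proof -
  let ?O = "{k \<in> {1..n}. odd k}" and ?S = "{k \<in> {1..n}. 6 dvd k}"
    and ?B = "{k \<in> {1..n}. \<not> 6 dvd k}" and ?A = "{k \<in> {1..n}. odd k \<or> 6 dvd k}"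
    and ?R = "{k \<in> {n<..2*n}. even k}"
  let ?p = "\<lambda>k. 1 + fps_X ^ k :: int fps" and ?m = "\<lambda>k. 1 - fps_X ^ k :: int fps"
  let ?F = "signed_partition_fps ?B"
  have "?A = ?O \<union> ?S"
    by auto
  then have "(\<Prod>k\<in>?A. 1 + (- fps_X) ^ k) = (\<Prod>k\<in>?O \<union> ?S. 1 + (- fps_X) ^ k :: int fps)"
    by (rule arg_cong)
  also have "\<dots> = (\<Prod>k\<in>?O. 1 + (- fps_X) ^ k) * (\<Prod>k\<in>?S. 1 + (- fps_X) ^ k)"
    by (rule prod.union_disjoint) auto
  \<comment> \<open>Replacing \<open>fps_X\<close> by \<open>- fps_X\<close> changes the sign of odd
    powers only, and multiples of 6 are even.\<close>
  also have "(\<Prod>k\<in>?O. 1 + (- fps_X) ^ k) = prod ?m ?O"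
    by (rule prod.cong) auto
  also have "(\<Prod>k\<in>?S. 1 + (- fps_X) ^ k) = prod ?p ?S"
    by (rule prod.cong) (auto elim!: dvdE)
  \<comment> \<open>Inserts \<open>prod ?p ?B * ?F = 1\<close>, so that \<open>?S\<close> and
    \<open>?B\<close> together supply all factors needed for Euler's identity.\<close>
  also have "prod ?m ?O * prod ?p ?S = prod ?m ?O * (prod ?p ?S * prod ?p ?B) * ?F"
    using prod_mult_signed_partition_fps[of ?B] by (simp add: mult.assoc)
  also have "prod ?p ?S * prod ?p ?B = prod ?p (?S \<union> ?B)"
    by (rule prod.union_disjoint[symmetric]) auto
  also have "?S \<union> ?B = {1..n}"
    by auto
  also have "prod ?m ?O * prod ?p {1..n} = prod ?m ?R"
    by (rule euler_odd_distinct_finite)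
  finally have "(\<Prod>k\<in>?A. 1 + (- fps_X) ^ k) $ n = (prod ?m ?R * ?F) $ n"
    by simp
  \<comment> \<open>Exponents in \<open>?R\<close> exceed \<open>n\<close>, so up to degree
    \<open>n\<close> the product over \<open>?R\<close> has only its constant term 1.\<close>
  also have "\<dots> = (\<Sum>i\<in>{0..n}. if i = 0 then ?F $ n else 0)"
    unfolding fps_mult_nth
    by (intro sum.cong refl) (subst fps_nth_prod_one_minus_X_power_low, auto)
  also have "\<dots> = ?F $ n"
    by simp
  also have "\<dots> = int (b_even 6 n) - int (b_odd 6 n)"
    by (rule fps_nth_signed_partition_fps_regular)
  finally show ?thesis
    by (subst (asm) fps_nth_prod_one_plus_uminus_X_power) (auto simp: Q2_eq_card)
qed

end
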